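(* Let $k\ge1$, $g\ge1$, $r\ge1$ be integers and $p\in(0,1)$. Let $\mathrm{NB}_{\rm II}(k,g,r)$ be the Type II negative binomial distribution of order $k$ with gap $g$. Then a random variable with distribution $\mathrm{NB}_{\rm II}(k,g,r)$ has the same distribution as $W+(r-1)(g-1)$, where $W$ has distribution $\mathrm{NB}_{\rm II}(k,1,r)$. Consequently, if $\mu(g)$ and $\sigma^2(g)$ denote the mean and variance of $\mathrm{NB}_{\rm II}(k,g,r)$, then $$\mu(g)=\mu(1)+(r-1)(g-1),\qquad \sigma^2(g)=\sigma^2(1).$$
   Context: Consider an infinite sequence of independent trials, each $S$ (success) with probability $p$ or $F$ (failure) with probability $q=1-p$. The success runs (of order $k$ with gap $g$) are defined inductively: the first success run is the first maximal run of at least $k$ consecutive successes; if the $j$-th success run terminates at trial $m$ (i.e. $m$ is its last success and trial $m+1$ is a failure), then the $(j+1)$-th success run is the first run of at least $k$ consecutive successes which begins later than trial $m+g$, taken maximal among runs beginning later than trial $m+g$. The distribution $\mathrm{NB}_{\rm II}(k,g,r)$ is the distribution of the number of trials needed until the $r$-th success run first attains length $k$, i.e. of the index of the $k$-th success trial of the $r$-th success run. *)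

theory Defs
  imports "HOL-Probability.Probability"
begin

text \<open>
  A sequence of trials is a predicate \<open>s :: nat \<Rightarrow> bool\<close>, where \<open>s i\<close> means that trial \<open>i\<close>
  is a success; trials are numbered \<open>1, 2, \<dots>\<close>, so \<open>s 0\<close> is never inspected.
  A run is represented by the set of its trials.  It may be infinite, i.e. never terminate
  (which is an event of probability zero when the success probability is below 1).
\<close>

definition consecutive :: "nat set \<Rightarrow> bool" where
  "consecutive R \<longleftrightarrow> (\<forall>a\<in>R. \<forall>c\<in>R. \<forall>b. a \<le> b \<and> b \<le> c \<longrightarrow> b \<in> R)"

definition runs_after :: "nat \<Rightarrow> (nat \<Rightarrow> bool) \<Rightarrow> nat \<Rightarrow> nat set set" where
  "runs_after k s l =
     {R. consecutive R \<and> (\<forall>i\<in>R. l < i \<and> s i) \<and> (infinite R \<or> k \<le> card R)}"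

definition maximal_run_after :: "nat \<Rightarrow> (nat \<Rightarrow> bool) \<Rightarrow> nat \<Rightarrow> nat set \<Rightarrow> bool" where
  "maximal_run_after k s l R \<longleftrightarrow>
     R \<in> runs_after k s l \<and> (\<forall>R'\<in>runs_after k s l. R \<subseteq> R' \<longrightarrow> R' = R)"

definition first_run_after :: "nat \<Rightarrow> (nat \<Rightarrow> bool) \<Rightarrow> nat \<Rightarrow> nat set \<Rightarrow> bool" where
  "first_run_after k s l R \<longleftrightarrow>
     maximal_run_after k s l R \<and> (\<forall>R'. maximal_run_after k s l R' \<longrightarrow> Inf R \<le> Inf R')"

text \<open>
  \<open>success_run k g s j R\<close>: the \<open>j\<close>-th success run of order \<open>k\<close> with gap \<open>g\<close> is \<open>R\<close>.
  If \<open>R\<close> is finite, it terminates at trial \<open>Max R\<close>; that the next trial is a failure is part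
  of maximality.
\<close>

inductive success_run :: "nat \<Rightarrow> nat \<Rightarrow> (nat \<Rightarrow> bool) \<Rightarrow> nat \<Rightarrow> nat set \<Rightarrow> bool"
  for k g :: nat and s :: "nat \<Rightarrow> bool" where
  first: "first_run_after k s 0 R \<Longrightarrow> success_run k g s 1 R"
| next_run: "success_run k g s j R \<Longrightarrow> finite R \<Longrightarrow> first_run_after k s (Max R + g) R'
    \<Longrightarrow> success_run k g s (Suc j) R'"

text \<open>
  The index of the \<open>k\<close>-th trial of the \<open>r\<close>-th success run, which is \<open>Inf R + k - 1\<close> because
  the trials of a run \<open>R\<close> are consecutive.  The value is unspecified if there is no \<open>r\<close>-th
  success run (an event of probability zero for success probability in \<open>(0,1)\<close>).
\<close>

definition waiting_time :: "nat \<Rightarrow> nat \<Rightarrow> nat \<Rightarrow> (nat \<Rightarrow> bool) \<Rightarrow> nat" where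
  "waiting_time k g r s = (THE n. \<exists>R. success_run k g s r R \<and> n = Inf R + k - 1)"

text \<open>Streams are indexed from 0, hence trial \<open>i\<close> is the stream element with index \<open>i - 1\<close>.\<close>

definition NB_II :: "real \<Rightarrow> nat \<Rightarrow> nat \<Rightarrow> nat \<Rightarrow> nat measure" where
  "NB_II p k g r =
     distr (stream_space (measure_pmf (bernoulli_pmf p))) (count_space UNIV)
       (\<lambda>\<omega>. waiting_time k g r (\<lambda>i. \<omega> !! (i - 1)))"

definition NB_II_mean :: "real \<Rightarrow> nat \<Rightarrow> nat \<Rightarrow> nat \<Rightarrow> real" where
  "NB_II_mean p k g r = prob_space.expectation (NB_II p k g r) real"

definition NB_II_variance :: "real \<Rightarrow> nat \<Rightarrow> nat \<Rightarrow> nat \<Rightarrow> real" where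
  "NB_II_variance p k g r = prob_space.variance (NB_II p k g r) real"

definition has_NB_II :: "'a measure \<Rightarrow> ('a \<Rightarrow> nat) \<Rightarrow> real \<Rightarrow> nat \<Rightarrow> nat \<Rightarrow> nat \<Rightarrow> bool" where
  "has_NB_II M X p k g r \<longleftrightarrow>
     prob_space M \<and> X \<in> M \<rightarrow>\<^sub>M count_space UNIV \<and>
     distr M (count_space UNIV) X = NB_II p k g r"

lemma consecutiveD:
  "consecutive R \<Longrightarrow> a \<in> R \<Longrightarrow> c \<in> R \<Longrightarrow> a \<le> b \<Longrightarrow> b \<le> c \<Longrightarrow> b \<in> R"
  unfolding consecutive_def by blast

lemma countable_consecutive: "countable {R. consecutive R}"
proof -
  have "R \<in> Collect finite \<union> range atLeast" if "consecutive R" for R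
  proof (cases "finite R")
    case False
    then have "R \<noteq> {}" by auto
    define a where "a = Inf R"
    have a: "a \<in> R" "\<And>x. x \<in> R \<Longrightarrow> a \<le> x"
      using Inf_nat_def1[OF \<open>R \<noteq> {}\<close>] by (auto simp: a_def intro: cInf_lower)
    have "R = {a..}"
    proof
      show "R \<subseteq> {a..}" using a(2) by auto
      show "{a..} \<subseteq> R"
      proof
        fix b assume "b \<in> {a..}"
        obtain c where "c \<in> R" "b \<le> c"
          using False unfolding infinite_nat_iff_unbounded_le by blast
        with \<open>b \<in> {a..}\<close> show "b \<in> R" using consecutiveD[OF that a(1)] by simp
      qed
    qed
    then show ?thesis by auto
  qed simp
  then have "{R. consecutive R} \<subseteq> Collect finite \<union> range atLeast" by (intro subsetI) simp
  moreover have "countable (Collect finite \<union> range atLeast :: nat set set)"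
    by (simp add: countable_Collect_finite)
  ultimately show ?thesis by (rule countable_subset)
qed

lemma first_run_after_unique:
  assumes k: "1 \<le> k" and R: "first_run_after k s l R" and Q: "first_run_after k s l Q"
  shows "R = Q"
proof -
  have ne: "A \<noteq> {}" if "first_run_after k s l A" for A
    using that k by (auto simp: first_run_after_def maximal_run_after_def runs_after_def)
  have eq: "Inf R = Inf Q"
    using R Q by (auto simp: first_run_after_def intro: antisym)
  let ?a = "Inf R"
  have aR: "?a \<in> R" using Inf_nat_def1[OF ne[OF R]] .
  have aQ: "?a \<in> Q" using Inf_nat_def1[OF ne[OF Q]] eq by simp
  have lb: "?a \<le> x" if "x \<in> R \<union> Q" for x
    using that cInf_lower[of x R] cInf_lower[of x Q] eq by auto
  have cR: "consecutive R" and cQ: "consecutive Q"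
    using R Q by (auto simp: first_run_after_def maximal_run_after_def runs_after_def)
  have "consecutive (R \<union> Q)"
    unfolding consecutive_def
  proof (intro ballI allI impI)
    fix x c b assume x: "x \<in> R \<union> Q" and c: "c \<in> R \<union> Q" and b: "x \<le> b \<and> b \<le> c"
    have "?a \<le> b" using lb[OF x] b by simp
    then show "b \<in> R \<union> Q" using c b aR aQ cR cQ unfolding consecutive_def by blast
  qed
  moreover have "k \<le> card (R \<union> Q)" if "finite (R \<union> Q)"
    using that R card_mono[OF that, of R]
    by (auto simp: first_run_after_def maximal_run_after_def runs_after_def)
  ultimately have "R \<union> Q \<in> runs_after k s l"
    using R Q by (auto simp: first_run_after_def maximal_run_after_def runs_after_def)
  then have "R \<union> Q = R" and "R \<union> Q = Q"
    using R Q by (auto simp only: first_run_after_def maximal_run_after_def Un_upper1 Un_upper2)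
  then show ?thesis by simp
qed

lemma success_run_0: "\<not> success_run k g s 0 R"
  by (auto elim: success_run.cases)

lemma success_run_Suc:
  "success_run k g s (Suc j) Q \<longleftrightarrow>
     (j = 0 \<and> first_run_after k s 0 Q) \<or>
     (\<exists>R. success_run k g s j R \<and> finite R \<and> first_run_after k s (Max R + g) Q)"
  by (subst success_run.simps) auto

lemma success_run_consecutive: "success_run k g s j R \<Longrightarrow> consecutive R"
  by (induction rule: success_run.induct)
     (auto simp: first_run_after_def maximal_run_after_def runs_after_def)

lemma success_run_unique:
  assumes "1 \<le> k"
  shows "success_run k g s j R \<Longrightarrow> success_run k g s j Q \<Longrightarrow> R = Q"
proof (induction j arbitrary: R Q)
  case 0
  then show ?case by (simp add: success_run_0)
next
  case (Suc j)
  show ?case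
  proof (cases "j = 0")
    case True
    then show ?thesis
      using Suc.prems first_run_after_unique[OF assms] by (auto simp: success_run_Suc success_run_0)
  next
    case False
    then obtain R' Q' where
      "success_run k g s j R'" "first_run_after k s (Max R' + g) R"
      "success_run k g s j Q'" "first_run_after k s (Max Q' + g) Q"
      using Suc.prems by (auto simp: success_run_Suc)
    then show ?thesis using Suc.IH first_run_after_unique[OF assms] by blast
  qed
qed

lemma waiting_time_eq:
  assumes "1 \<le> k" and "success_run k g s r R"
  shows "waiting_time k g r s = Inf R + k - 1"
  unfolding waiting_time_def using success_run_unique[OF assms(1)] assms(2) by blast

lemma pred_countable_Bex:
  assumes "countable I" and "\<And>i. i \<in> I \<Longrightarrow> Measurable.pred M (\<lambda>x. P x i)"
  shows "Measurable.pred M (\<lambda>x. \<exists>i\<in>I. P x i)"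
proof -
  have "{x \<in> space M. \<exists>i\<in>I. P x i} = (\<Union>i\<in>I. {x \<in> space M. P x i})" by blast
  also have "\<dots> \<in> sets M" using assms by (intro sets.countable_UN') (auto simp: pred_def)
  finally show ?thesis by (simp add: pred_def)
qed

lemma pred_countable_Ball:
  assumes "countable I" and "\<And>i. i \<in> I \<Longrightarrow> Measurable.pred M (\<lambda>x. P x i)"
  shows "Measurable.pred M (\<lambda>x. \<forall>i\<in>I. P x i)"
proof -
  have "Measurable.pred M (\<lambda>x. \<not> (\<exists>i\<in>I. \<not> P x i))"
    using assms by (intro pred_intros_logic pred_countable_Bex) auto
  then show ?thesis by simp
qed

context
  fixes p :: real
begin

abbreviation (input) "trials \<equiv> stream_space (measure_pmf (bernoulli_pmf p))"

abbreviation (input) "outcome \<omega> \<equiv> (\<lambda>i. \<omega> !! (i - 1))"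

lemma pred_runs_after:
  "Measurable.pred trials (\<lambda>\<omega>. R \<in> runs_after k (outcome \<omega>) l)"
proof -
  have [measurable]: "Measurable.pred trials (\<lambda>\<omega>. \<omega> !! n)" for n
  proof -
    have "(\<lambda>\<omega>. \<omega> !! n) \<in> trials \<rightarrow>\<^sub>M measure_pmf (bernoulli_pmf p)" by measurable
    then show ?thesis by (simp cong: measurable_cong_sets)
  qed
  show ?thesis unfolding runs_after_def mem_Collect_eq by measurable
qed

lemma pred_maximal_run_after:
  "Measurable.pred trials (\<lambda>\<omega>. maximal_run_after k (outcome \<omega>) l R)"
proof -
  have eq: "maximal_run_after k s l R \<longleftrightarrow> R \<in> runs_after k s l \<and>
      (\<forall>R'\<in>{R. consecutive R}. R' \<in> runs_after k s l \<longrightarrow> R \<subseteq> R' \<longrightarrow> R' = R)" for s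
    by (auto simp: maximal_run_after_def runs_after_def)
  show ?thesis
    unfolding eq
    by (intro pred_intros_logic pred_countable_Ball countable_consecutive pred_runs_after) simp_all
qed

lemma pred_first_run_after:
  "Measurable.pred trials (\<lambda>\<omega>. first_run_after k (outcome \<omega>) l R)"
proof -
  have eq: "first_run_after k s l R \<longleftrightarrow> maximal_run_after k s l R \<and>
      (\<forall>R'\<in>{R. consecutive R}. maximal_run_after k s l R' \<longrightarrow> Inf R \<le> Inf R')" for s
    by (auto simp: first_run_after_def maximal_run_after_def runs_after_def)
  show ?thesis
    unfolding eq
    by (intro pred_intros_logic pred_countable_Ball countable_consecutive pred_maximal_run_after) simp_all
qed

lemma pred_success_run:
  "Measurable.pred trials (\<lambda>\<omega>. success_run k g (outcome \<omega>) j R)"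
proof (induction j arbitrary: R)
  case 0
  then show ?case by (simp add: success_run_0)
next
  case (Suc j)
  have eq: "success_run k g s (Suc j) R \<longleftrightarrow> (j = 0 \<and> first_run_after k s 0 R) \<or>
      (\<exists>R'\<in>{R. consecutive R}. success_run k g s j R' \<and> finite R' \<and>
         first_run_after k s (Max R' + g) R)" for s
    unfolding success_run_Suc Bex_def mem_Collect_eq
    by (intro disj_cong ex_cong1 refl) (auto dest: success_run_consecutive)
  show ?case
    unfolding eq
    by (intro pred_intros_logic pred_countable_Bex countable_consecutive
      pred_first_run_after Suc.IH) simp_all
qed

lemma measurable_waiting_time:
  assumes "1 \<le> k"
  shows "(\<lambda>\<omega>. waiting_time k g r (outcome \<omega>)) \<in> trials \<rightarrow>\<^sub>M count_space UNIV"
  unfolding waiting_time_def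
proof (rule measurable_THE[where I = UNIV])
  fix n
  have eq: "(\<exists>R. success_run k g s r R \<and> n = Inf R + k - 1) \<longleftrightarrow>
      (\<exists>R\<in>{R. consecutive R}. success_run k g s r R \<and> n = Inf R + k - 1)" for s
    unfolding Bex_def mem_Collect_eq
    by (intro ex_cong1) (auto dest: success_run_consecutive)
  show "Measurable.pred trials
      (\<lambda>\<omega>. \<exists>R. success_run k g (outcome \<omega>) r R \<and> n = Inf R + k - 1)"
    unfolding eq
    by (intro pred_intros_logic pred_countable_Bex countable_consecutive pred_success_run) simp_all
qed (use success_run_unique[OF assms] in blast)+

end

lemma prob_space_NB_II:
  assumes "1 \<le> k"
  shows "prob_space (NB_II p k g r)"
proof -
  interpret prob_space "stream_space (measure_pmf (bernoulli_pmf p))"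
    by (rule prob_space.prob_space_stream_space) (rule measure_pmf.prob_space_axioms)
  show ?thesis
    unfolding NB_II_def by (rule prob_space_distr[OF measurable_waiting_time[OF assms]])
qed

end

theory Submission
  imports Defs
begin

text \<open>
  A finite automaton recognises the success runs while reading the trials, and the waiting time is
  almost surely its hitting time of the state reached when the last run attains length \<open>k\<close>.
  The gap \<open>g\<close> enters only through \<open>g - 1\<close> trials that are skipped, whatever their outcome, after the
  failure ending a run.  Hence a first-step recursion shows that each of the \<open>r - 1\<close> terminating runs
  delays the hitting probabilities by exactly \<open>g - 1\<close>.  Since every state
  has a path of bounded length to the final one, the hitting time has a geometric tail, which gives
  almost sure finiteness and all moments.
\<close>

section \<open>First blocks of successes\<close>

text \<open>The window consists of the \<open>k\<close> trials ending at \<open>m\<close>; writing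
  \<open>m < i + k\<close> avoids truncated subtraction, and \<open>l + k \<le> m\<close> makes the
  window start after \<open>l\<close>.\<close>

definition block :: "nat \<Rightarrow> (nat \<Rightarrow> bool) \<Rightarrow> nat \<Rightarrow> nat \<Rightarrow> bool" where
  "block k s l m \<longleftrightarrow> l + k \<le> m \<and> (\<forall>i. m < i + k \<and> i \<le> m \<longrightarrow> s i)"

text \<open>If every element of \<open>R\<close> were below \<open>Inf R + k - 1\<close>, then
  \<open>R\<close> would fit into \<open>k - 1\<close> numbers. So some element lies at or beyond
  that trial, and consecutiveness fills the window.\<close>

lemma runs_after_block:
  assumes k: "1 \<le> k" and R: "R \<in> runs_after k s l"
  shows "Inf R \<in> R" and "block k s l (Inf R + k - 1)"
proof -
  have "R \<noteq> {}" using R k by (auto simp: runs_after_def)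
  then show a: "Inf R \<in> R" by (rule Inf_nat_def1)
  have lb: "Inf R \<le> x" if "x \<in> R" for x using that by (auto intro: cInf_lower)
  have cR: "consecutive R" and pos: "\<And>i. i \<in> R \<Longrightarrow> l < i \<and> s i" and sz: "infinite R \<or> k \<le> card R"
    using R by (auto simp: runs_after_def)
  obtain b where b: "b \<in> R" "Inf R + k - 1 \<le> b"
  proof (rule ccontr)
    assume no: "\<not> thesis"
    have sub: "R \<subseteq> {Inf R..<Inf R + k - 1}"
    proof
      fix x assume "x \<in> R"
      then show "x \<in> {Inf R..<Inf R + k - 1}" using no that[of x] lb[of x] by (auto simp: not_le[symmetric])
    qed
    have "finite R" using sub by (rule finite_subset) simp
    moreover have "card R \<le> k - 1" using card_mono[OF _ sub] by simp
    ultimately show False using sz k by simp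
  qed
  have "s i" if "Inf R + k - 1 < i + k" "i \<le> Inf R + k - 1" for i
  proof -
    have "i \<in> R" by (rule consecutiveD[OF cR a b(1)]) (use that b(2) k in auto)
    then show ?thesis using pos by blast
  qed
  then show "block k s l (Inf R + k - 1)" using pos[OF a] k by (auto simp: block_def)
qed

text \<open>The run starts at \<open>m + 1 - k\<close> and extends to the right as long as trials
  succeed. An extension to the left would give a block ending at \<open>m - 1\<close>, against the
  minimality of \<open>m\<close>.\<close>

lemma first_run_after_exists:
  assumes k: "1 \<le> k" and m: "block k s l m" and first: "\<And>m'. m' < m \<Longrightarrow> \<not> block k s l m'"
  shows "\<exists>R. first_run_after k s l R \<and> Inf R + k - 1 = m"
proof -
  define a where "a = m + 1 - k"
  define R where "R = {i. a \<le> i \<and> (\<forall>j. a \<le> j \<and> j \<le> i \<longrightarrow> s j)}"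
  have lm: "l + k \<le> m" and sm: "\<And>i. m < i + k \<Longrightarrow> i \<le> m \<Longrightarrow> s i"
    using m by (auto simp: block_def)
  have am: "{a..m} \<subseteq> R" using sm lm by (auto simp: R_def a_def)
  have aR: "a \<in> R" using am lm k by (auto simp: a_def)
  have Inf: "Inf R = a"
    using aR by (intro cInf_eq_minimum) (auto simp: R_def)
  have "infinite R \<or> k \<le> card R"
  proof -
    have "k = card {a..m}" using lm k by (auto simp: a_def)
    then show ?thesis using card_mono[OF _ am] by auto
  qed
  then have run: "R \<in> runs_after k s l"
    using lm by (auto simp: runs_after_def R_def consecutive_def a_def)
  have "R' = R" if R': "R' \<in> runs_after k s l" and sub: "R \<subseteq> R'" for R'
  proof
    have cR: "consecutive R'" and pos: "\<And>i. i \<in> R' \<Longrightarrow> l < i \<and> s i"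
      using R' by (auto simp: runs_after_def)
    have aR': "a \<in> R'" using aR sub by blast
    show "R' \<subseteq> R"
    proof
      fix x assume x: "x \<in> R'"
      show "x \<in> R"
      proof (cases "a \<le> x")
        case True
        have "s j" if "a \<le> j" "j \<le> x" for j
          using consecutiveD[OF cR aR' x that] pos by blast
        then show ?thesis using True by (auto simp: R_def)
      next
        case False
        have "a - 1 \<in> R'" by (rule consecutiveD[OF cR x aR']) (use False in auto)
        then have "l < a - 1" "s (a - 1)" using pos by auto
        have "s i" if "m - 1 < i + k" "i \<le> m - 1" for i
        proof (cases "i = a - 1")
          case False
          then have "m < i + k" using that k lm by (auto simp: a_def)
          then show ?thesis using sm that by simp
        qed (use \<open>s (a - 1)\<close> in simp)
        then have "block k s l (m - 1)" using \<open>l < a - 1\<close> k by (auto simp: block_def a_def)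
        then show ?thesis using first[of "m - 1"] lm k by simp
      qed
    qed
  qed (use sub in simp)
  then have max: "maximal_run_after k s l R" using run by (auto simp: maximal_run_after_def)
  have "Inf R \<le> Inf R'" if "maximal_run_after k s l R'" for R'
  proof -
    have "block k s l (Inf R' + k - 1)"
      using that runs_after_block[OF k] by (auto simp: maximal_run_after_def)
    then have "m \<le> Inf R' + k - 1" using first by (meson not_le)
    then show ?thesis using Inf k by (simp add: a_def)
  qed
  then have "first_run_after k s l R" using max by (auto simp: first_run_after_def)
  moreover have "Inf R + k - 1 = m" using Inf lm k by (auto simp: a_def)
  ultimately show ?thesis by blast
qed

lemma block_imp_first_run:
  assumes k: "1 \<le> k" and "block k s l n"
  shows "\<exists>R. first_run_after k s l R \<and> Inf R + k - 1 \<le> n \<and>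
    (\<forall>m. m < Inf R + k - 1 \<longrightarrow> \<not> block k s l m)"
proof -
  define m where "m = (LEAST m. block k s l m)"
  have m: "block k s l m" unfolding m_def using assms(2) by (rule LeastI)
  have first: "\<not> block k s l m'" if "m' < m" for m'
    using that not_less_Least unfolding m_def by blast
  have "m \<le> n" unfolding m_def using assms(2) by (rule Least_le)
  then show ?thesis using first_run_after_exists[OF k m first] first by metis
qed

text \<open>By uniqueness \<open>R\<close> is the run built from the least block, so it inherits
  minimality.\<close>

lemma first_run_after_block:
  assumes k: "1 \<le> k" and R: "first_run_after k s l R"
  shows "block k s l (Inf R + k - 1)" and "m < Inf R + k - 1 \<Longrightarrow> \<not> block k s l m"
proof -
  show b: "block k s l (Inf R + k - 1)"
    using R runs_after_block[OF k] by (auto simp: first_run_after_def maximal_run_after_def)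
  show "\<not> block k s l m" if "m < Inf R + k - 1"
    using block_imp_first_run[OF k b] first_run_after_unique[OF k _ R] that by blast
qed

lemma first_run_after_success:
  assumes "1 \<le> k" and "first_run_after k s l R" and "Inf R \<le> i" and "infinite R \<or> i \<le> Max R"
  shows "s i"
proof -
  have R: "R \<in> runs_after k s l" using assms(2) by (auto simp: first_run_after_def maximal_run_after_def)
  have a: "Inf R \<in> R" by (rule runs_after_block[OF assms(1) R])
  have "\<exists>b\<in>R. i \<le> b"
  proof (cases "finite R")
    case True
    have "Max R \<in> R" by (rule Max_in[OF True]) (use a in blast)
    moreover have "i \<le> Max R" using True assms(4) by simp
    ultimately show ?thesis by blast
  next
    case False
    then show ?thesis unfolding infinite_nat_iff_unbounded_le by blast
  qed
  then obtain b where b: "b \<in> R" "i \<le> b" by blast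
  have "consecutive R" using R by (simp add: runs_after_def)
  from consecutiveD[OF this a b(1) assms(3) b(2)] have "i \<in> R" .
  then show ?thesis using R by (auto simp: runs_after_def)
qed

text \<open>A success right after \<open>Max R\<close> could be added to \<open>R\<close>,
  contradicting maximality.\<close>

lemma first_run_after_terminates:
  assumes "1 \<le> k" and "first_run_after k s l R" and fin: "finite R"
  shows "\<not> s (Suc (Max R))"
proof
  assume s: "s (Suc (Max R))"
  have R: "R \<in> runs_after k s l" and max: "\<And>R'. R' \<in> runs_after k s l \<Longrightarrow> R \<subseteq> R' \<Longrightarrow> R' = R"
    using assms(2) by (auto simp: first_run_after_def maximal_run_after_def)
  have "Inf R \<in> R" by (rule runs_after_block[OF assms(1) R])
  then have MR: "Max R \<in> R" using fin by (intro Max_in) auto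
  have le: "x \<le> Max R" if "x \<in> R" for x using that fin by simp
  have "consecutive (insert (Suc (Max R)) R)"
    unfolding consecutive_def
  proof (intro ballI allI impI)
    fix x c b assume *: "x \<in> insert (Suc (Max R)) R" "c \<in> insert (Suc (Max R)) R" "x \<le> b \<and> b \<le> c"
    have cR: "consecutive R" using R by (simp add: runs_after_def)
    show "b \<in> insert (Suc (Max R)) R"
    proof (cases "b = Suc (Max R)")
      case False
      then have "b \<le> Max R" and "x \<in> R" using * le by force+
      then show ?thesis using consecutiveD[OF cR _ MR] * by blast
    qed simp
  qed
  moreover have "k \<le> card (insert (Suc (Max R)) R)"
    using R fin by (auto simp: runs_after_def card_insert_if)
  ultimately have "insert (Suc (Max R)) R \<in> runs_after k s l"
    using R s MR fin by (auto simp: runs_after_def)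
  then have "Suc (Max R) \<in> R" using max by blast
  then show False using le by fastforce
qed

lemma success_run_first_run_after:
  "success_run k g s j R \<Longrightarrow> \<exists>l. first_run_after k s l R"
  by (induction rule: success_run.induct) auto

section \<open>Success runs recognised by an automaton\<close>

text \<open>
  \<open>Seek d c j\<close>: \<open>d\<close> trials are still to be skipped, the current streak of counted successes has
  length \<open>c\<close>, and \<open>j\<close> further runs are needed after the one being sought.
  \<open>Within j\<close>: a run has attained length \<open>k\<close> and has not terminated, and \<open>j\<close> further runs are needed.
\<close>

datatype state = Seek nat nat nat | Within nat

context
  fixes k g :: nat
begin

text \<open>The failure that ends a run is itself the first of the \<open>g\<close> trials after it,
  so only \<open>g - 1\<close> remain to be skipped. \<open>Within 0\<close> is absorbing because
  only the time of its first visit matters.\<close>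

fun step :: "state \<Rightarrow> bool \<Rightarrow> state" where
  "step (Seek (Suc d) c j) b = Seek d c j"
| "step (Seek 0 c j) True = (if Suc c = k then Within j else Seek 0 (Suc c) j)"
| "step (Seek 0 c j) False = Seek 0 0 j"
| "step (Within 0) b = Within 0"
| "step (Within (Suc j)) True = Within (Suc j)"
| "step (Within (Suc j)) False = Seek (g - 1) 0 j"

primrec traj :: "(nat \<Rightarrow> bool) \<Rightarrow> state \<Rightarrow> nat \<Rightarrow> state" where
  "traj s st 0 = st"
| "traj s st (Suc n) = step (traj s st n) (s (Suc n))"

lemma traj_absorbing:
  assumes "n \<le> n'" and "traj s st n = Within 0"
  shows "traj s st n' = Within 0"
  using assms by (induction n' rule: dec_induct) auto

lemma traj_Within_successes:
  assumes "n \<le> n'" and "traj s st n = Within j" and "\<And>i. n < i \<Longrightarrow> i \<le> n' \<Longrightarrow> s i"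
  shows "traj s st n' = Within j"
  using assms
proof (induction n' rule: dec_induct)
  case (step i)
  then show ?case by (cases j) auto
qed simp

lemma traj_skip: "traj s st n = Seek d c j \<Longrightarrow> traj s st (n + d) = Seek 0 c j"
proof (induction d arbitrary: n)
  case (Suc d)
  then show ?case using Suc.IH[of "Suc n"] by simp
qed simp

text \<open>Invariant of the search: \<open>c\<close> is exactly the length of the current streak
  counted from \<open>l\<close>. The last disjunct expresses exactness: the streak fills all trials
  since \<open>l\<close>, or a failure precedes it.\<close>

lemma traj_no_block:
  assumes "1 \<le> k" and "l \<le> n" and "traj s st l = Seek 0 0 j"
    and "\<And>m. m \<le> n \<Longrightarrow> \<not> block k s l m"
  shows "\<exists>c<k. traj s st n = Seek 0 c j \<and> l + c \<le> n \<and> (\<forall>i. n < i + c \<and> i \<le> n \<longrightarrow> s i) \<and>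
    (n = l + c \<or> \<not> s (n - c))"
  using assms(2,4)
proof (induction n rule: dec_induct)
  case base
  then show ?case using assms(1,3) by auto
next
  case (step n)
  then obtain c where c: "c < k" "traj s st n = Seek 0 c j" "l + c \<le> n"
    "\<And>i. n < i + c \<Longrightarrow> i \<le> n \<Longrightarrow> s i" "n = l + c \<or> \<not> s (n - c)" by force
  show ?case
  proof (cases "s (Suc n)")
    case False
    then show ?thesis using c step.hyps assms(1) by (intro exI[of _ 0]) auto
  next
    case True
    have all: "s i" if "Suc n < i + Suc c" "i \<le> Suc n" for i
      using that True c(4) by (cases "i = Suc n") auto
    have "Suc c \<noteq> k"
      using step.prems[of "Suc n"] all c(3) by (auto simp: block_def)
    then show ?thesis using True c all by (intro exI[of _ "Suc c"]) auto
  qed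
qed

lemma traj_first_run:
  assumes k: "1 \<le> k" and l: "traj s st l = Seek 0 0 j" and R: "first_run_after k s l R"
  shows "traj s st (Inf R + k - 1) = Within j" and "n < Inf R + k - 1 \<Longrightarrow> traj s st n \<noteq> Within 0"
proof -
  let ?m = "Inf R + k - 1"
  note b = first_run_after_block[OF k R]
  have lm: "l + k \<le> ?m" and sm: "\<And>i. ?m < i + k \<Longrightarrow> i \<le> ?m \<Longrightarrow> s i"
    using b(1) by (auto simp: block_def)
  define m where "m = ?m - 1"
  have mm: "?m = Suc m" using lm k by (simp add: m_def)
  have "l \<le> m" using lm mm k by simp
  have "\<not> block k s l i" if "i \<le> m" for i using b(2) mm that by simp
  from traj_no_block[OF k \<open>l \<le> m\<close> l this]
  obtain c where c: "c < k" "traj s st m = Seek 0 c j" "l + c \<le> m" "m = l + c \<or> \<not> s (m - c)"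
    by blast
  \<comment> \<open>A shorter streak could not reach back to \<open>l\<close>, so a failure would
    precede it, and that failure would fall into the window of the block ending at
    \<open>?m\<close>.\<close>
  have "Suc c = k"
  proof (rule ccontr)
    assume "Suc c \<noteq> k"
    then have "Suc c < k" using c(1) by simp
    then have "m \<noteq> l + c" using lm mm by simp
    then have "\<not> s (m - c)" using c(4) by simp
    then show False using sm[of "m - c"] \<open>Suc c < k\<close> mm lm by simp
  qed
  moreover have "s (Suc m)" using sm[of "Suc m"] mm k by simp
  ultimately show "traj s st ?m = Within j" using c(2) unfolding mm by simp
  show "traj s st n \<noteq> Within 0" if "n < ?m"
    using traj_absorbing[of n m s st] that mm c(2) by auto
qed

text \<open>The automaton waits in \<open>Within (Suc j)\<close> up to \<open>Max R\<close>, reads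
  the failure at \<open>Suc (Max R)\<close> and skips \<open>g - 1\<close> trials. It thus resumes
  at \<open>Max R + g\<close>, the point after which the next run may begin.\<close>

lemma traj_run_end:
  assumes k: "1 \<le> k" and g: "1 \<le> g" and R: "first_run_after k s l R" and fin: "finite R"
    and "traj s st (Inf R + k - 1) = Within (Suc j)"
  shows "traj s st (Max R + g) = Seek 0 0 j"
proof -
  have run: "R \<in> runs_after k s l" using R by (auto simp: first_run_after_def maximal_run_after_def)
  have "R \<subseteq> {Inf R..Max R}" using fin by (auto intro: cInf_lower)
  then have "card R \<le> card {Inf R..Max R}" by (intro card_mono) auto
  moreover have "k \<le> card R" using run fin by (simp add: runs_after_def)
  ultimately have le: "Inf R + k - 1 \<le> Max R" using k unfolding card_atLeastAtMost by linarith
  have "traj s st (Max R) = Within (Suc j)"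
  proof (rule traj_Within_successes[OF le assms(5)])
    fix i assume "Inf R + k - 1 < i" "i \<le> Max R"
    then show "s i" using first_run_after_success[OF k R] k by auto
  qed
  then have "traj s st (Suc (Max R)) = Seek (g - 1) 0 j"
    using first_run_after_terminates[OF k R fin] by simp
  from traj_skip[OF this] show ?thesis using g by simp
qed

text \<open>\<open>Seek 0 0 r\<close> asks for \<open>r + 1\<close> runs in all, whence
  \<open>i + j = Suc r\<close>. For \<open>j = 0\<close> the claim makes
  \<open>Inf R + k - 1\<close> the hitting time of \<open>Within 0\<close>.\<close>

lemma traj_success_run:
  assumes k: "1 \<le> k" and g: "1 \<le> g"
  shows "success_run k g s i R \<Longrightarrow> i + j = Suc r \<Longrightarrow>
    traj s (Seek 0 0 r) (Inf R + k - 1) = Within j \<and>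
    (\<forall>n < Inf R + k - 1. traj s (Seek 0 0 r) n \<noteq> Within 0)"
proof (induction arbitrary: j rule: success_run.induct)
  case (first R)
  then show ?case using traj_first_run[OF k, of s "Seek 0 0 r" 0 j] by auto
next
  case (next_run i R R')
  obtain l where l: "first_run_after k s l R"
    using success_run_first_run_after[OF next_run.hyps(1)] by blast
  have "traj s (Seek 0 0 r) (Inf R + k - 1) = Within (Suc j)"
    using next_run.IH[of "Suc j"] next_run.prems by simp
  from traj_run_end[OF k g l next_run.hyps(2) this]
  have "traj s (Seek 0 0 r) (Max R + g) = Seek 0 0 j" .
  then show ?case using traj_first_run[OF k _ next_run.hyps(3)] by blast
qed

text \<open>Without a first run no block after \<open>l\<close> is ever completed, and
  \<open>traj_no_block\<close> keeps the automaton in \<open>Seek\<close> forever.\<close>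

lemma traj_Within_imp_first_run:
  assumes k: "1 \<le> k" and "traj s st l = Seek 0 0 j" and "traj s st n = Within 0"
  shows "\<exists>R. first_run_after k s l R"
proof (rule ccontr)
  assume no: "\<nexists>R. first_run_after k s l R"
  \<comment> \<open>A visit to \<open>Within 0\<close> before \<open>l\<close> would persist up to
    \<open>l\<close>.\<close>
  have "l \<le> n" using traj_absorbing[OF _ assms(3)] assms(2) by (metis nat_le_linear state.distinct(1))
  have "\<not> block k s l m" for m using block_imp_first_run[OF k] no by blast
  from traj_no_block[OF k \<open>l \<le> n\<close> assms(2) this] show False using assms(3) by auto
qed

text \<open>Converse of \<open>traj_success_run\<close>: hitting \<open>Within 0\<close> forces all
  required runs to exist, so the description in \<open>waiting_time\<close> has a value.\<close>

lemma traj_Within_imp_success_run: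
  assumes k: "1 \<le> k" and g: "1 \<le> g" and n: "traj s (Seek 0 0 r) n = Within 0"
  shows "i \<le> r \<Longrightarrow> \<exists>R. success_run k g s (Suc i) R"
proof (induction i)
  case 0
  obtain R where "first_run_after k s 0 R"
    using traj_Within_imp_first_run[OF k _ n, of 0 r] by auto
  then have "success_run k g s 1 R" by (rule success_run.first)
  then show ?case by auto
next
  case (Suc i)
  then obtain R where R: "success_run k g s (Suc i) R" by auto
  obtain l where l: "first_run_after k s l R"
    using success_run_first_run_after[OF R] by blast
  obtain j where j: "Suc i + Suc j = Suc r" using Suc.prems by (metis add_Suc_right le_Suc_ex add_Suc)
  have t: "traj s (Seek 0 0 r) (Inf R + k - 1) = Within (Suc j)"
    using traj_success_run[OF k g R j] by blast
  have fin: "finite R"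
  proof (rule ccontr)
    assume inf: "infinite R"
    \<comment> \<open>At the later of the two times the state would be
      \<open>Within (Suc j)\<close>, since an infinite run has no failure, and also
      \<open>Within 0\<close> by absorption.\<close>
    have "traj s (Seek 0 0 r) (max n (Inf R + k - 1)) = Within (Suc j)"
    proof (rule traj_Within_successes[OF _ t])
      fix i assume "Inf R + k - 1 < i"
      then show "s i" using first_run_after_success[OF k l] inf k by auto
    qed simp
    then show False using traj_absorbing[OF _ n, of "max n (Inf R + k - 1)"] by simp
  qed
  from traj_Within_imp_first_run[OF k traj_run_end[OF k g l fin t] n]
  show ?case using success_run.next_run[OF R fin] by blast
qed

text \<open>The hypothesis that \<open>Within 0\<close> is hit at some time excludes the unspecified
  value of \<open>waiting_time\<close>. The right-hand side depends on the first \<open>m\<close>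
  trials only.\<close>

lemma waiting_time_le_iff:
  assumes k: "1 \<le> k" and g: "1 \<le> g" and n: "traj s (Seek 0 0 r) n = Within 0"
  shows "waiting_time k g (Suc r) s \<le> m \<longleftrightarrow> traj s (Seek 0 0 r) m = Within 0"
proof -
  obtain R where R: "success_run k g s (Suc r) R"
    using traj_Within_imp_success_run[OF k g n, of r] by auto
  have "traj s (Seek 0 0 r) (Inf R + k - 1) = Within 0"
    and "\<And>n. n < Inf R + k - 1 \<Longrightarrow> traj s (Seek 0 0 r) n \<noteq> Within 0"
    using traj_success_run[OF k g R, of 0] by auto
  then show ?thesis
    unfolding waiting_time_eq[OF k R] using traj_absorbing not_le by blast
qed

lemma traj_outcome: "traj (outcome \<omega>) st n = foldl step st (stake n \<omega>)"
  by (induction n) (simp_all add: stake_Suc del: stake.simps(2))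

section \<open>Hitting probabilities\<close>

text \<open>Probability of reaching \<open>Within 0\<close> in at most \<open>n\<close> trials,
  given by conditioning on the first trial; \<open>emeasure_hit\<close> links it to the stream
  measure.\<close>

primrec hit_prob :: "real \<Rightarrow> nat \<Rightarrow> state \<Rightarrow> real" where
  "hit_prob p 0 st = of_bool (st = Within 0)"
| "hit_prob p (Suc n) st = p * hit_prob p n (step st True) + (1 - p) * hit_prob p n (step st False)"

lemma hit_prob_Within_0 [simp]: "hit_prob p n (Within 0) = 1"
  by (induction n) auto

lemma hit_prob_skip: "hit_prob p (n + d) (Seek d c j) = hit_prob p n (Seek 0 c j)"
  by (induction d) (auto simp: algebra_simps)

lemma hit_prob_bounds:
  assumes "0 \<le> p" "p \<le> 1"
  shows "0 \<le> hit_prob p n st \<and> hit_prob p n st \<le> 1"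
proof (induction n arbitrary: st)
  case (Suc n)
  have "p * hit_prob p n (step st True) + (1 - p) * hit_prob p n (step st False) \<le> p * 1 + (1 - p) * 1"
    using assms Suc by (intro add_mono mult_left_mono) auto
  then show ?case using assms Suc by auto
qed simp

lemma hit_prob_Suc_ge:
  assumes "0 \<le> p" "p \<le> 1"
  shows "hit_prob p n st \<le> hit_prob p (Suc n) st"
proof (induction n arbitrary: st)
  case 0
  show ?case
  proof (cases "st = Within 0")
    case False
    then show ?thesis using hit_prob_bounds[OF assms, of "Suc 0" st] by (simp del: hit_prob.simps(2))
  qed simp
next
  case (Suc n)
  show ?case
    unfolding hit_prob.simps(2)[of p n st] hit_prob.simps(2)[of p "Suc n" st]
    using assms Suc by (intro add_mono mult_left_mono) auto
qed

lemma hit_prob_mono: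
  assumes "0 \<le> p" "p \<le> 1" "n \<le> m"
  shows "hit_prob p n st \<le> hit_prob p m st"
  by (rule lift_Suc_mono_le[of "\<lambda>n. hit_prob p n st", OF _ assms(3)])
    (rule hit_prob_Suc_ge[OF assms(1,2)])

section \<open>The gap as a deterministic delay\<close>

text \<open>A crude lower bound on the time to \<open>Within 0\<close>: the forced skips plus one
  trial. It drops by at most one per step, which is all that \<open>hit_prob_eq_0\<close>
  needs.\<close>

fun min_time :: "state \<Rightarrow> nat" where
  "min_time (Seek d c j) = d + j * (g - 1) + 1"
| "min_time (Within 0) = 0"
| "min_time (Within (Suc j)) = Suc j * (g - 1) + 1"

lemma min_time_step: "min_time st \<le> Suc (min_time (step st b))"
proof (cases "(st, b)" rule: step.cases)
  case (2 c j)
  have "j * (g - 1) \<le> min_time (Within j)" by (cases j) simp_all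
  then show ?thesis using 2 by simp
qed auto

lemma hit_prob_eq_0: "n < min_time st \<Longrightarrow> hit_prob p n st = 0"
proof (induction n arbitrary: st)
  case (Suc n)
  have "n < min_time (step st b)" for b
    using Suc.prems min_time_step[of st b] by simp
  then show ?case using Suc.IH by simp
qed auto

end

text \<open>Both sides obey the same first-step recursion, except when a run ends with further runs
  needed: gap \<open>g\<close> then inserts \<open>g - 1\<close> skipped trials, which use up one of
  the \<open>j\<close> units of delay. At \<open>n = 0\<close> with \<open>j > 0\<close> both sides
  vanish.\<close>

lemma hit_prob_gap:
  assumes g: "1 \<le> g"
  shows "hit_prob k g p (n + j * (g - 1)) (Seek 0 c j) = hit_prob k 1 p n (Seek 0 c j) \<and>
    hit_prob k g p (n + j * (g - 1)) (Within j) = hit_prob k 1 p n (Within j)"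
proof (induction n arbitrary: c j)
  case 0
  have "hit_prob k g p (j * (g - 1)) (Seek 0 c j) = 0"
    by (rule hit_prob_eq_0) simp
  moreover have "hit_prob k g p (j * (g - 1)) (Within j) = 0" if "j \<noteq> 0"
    by (rule hit_prob_eq_0) (use that in \<open>cases j; simp\<close>)
  ultimately show ?case by (cases "j = 0") auto
next
  case (Suc n)
  have *: "hit_prob k g p (n + j * (g - 1)) (Seek 0 c j) = hit_prob k 1 p n (Seek 0 c j)"
    "hit_prob k g p (n + j * (g - 1)) (Within j) = hit_prob k 1 p n (Within j)" for c j
    using Suc by auto
  have "hit_prob k g p (Suc n + j * (g - 1)) (Within j) = hit_prob k 1 p (Suc n) (Within j)"
  proof (cases j)
    case (Suc i)
    have "hit_prob k g p (n + j * (g - 1)) (Seek (g - 1) 0 i) = hit_prob k g p (n + i * (g - 1)) (Seek 0 0 i)"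
    proof -
      have "n + j * (g - 1) = n + i * (g - 1) + (g - 1)" using Suc by simp
      then show ?thesis by (simp only: hit_prob_skip)
    qed
    then show ?thesis using *(1)[of i 0] *(2)[of j] by (simp add: Suc)
  qed simp
  moreover have "hit_prob k g p (Suc n + j * (g - 1)) (Seek 0 c j) = hit_prob k 1 p (Suc n) (Seek 0 c j)"
    using * by simp
  ultimately show ?case by blast
qed

section \<open>Geometric tail of the hitting time\<close>

text \<open>Length of a favourable path to \<open>Within 0\<close>: the remaining skips, the
  \<open>k - c\<close> missing successes, and for each further run one failure, \<open>g - 1\<close>
  skips and \<open>k\<close> successes.\<close>

fun path_length :: "nat \<Rightarrow> nat \<Rightarrow> state \<Rightarrow> nat" where
  "path_length k g (Seek d c j) = d + (k - c) + j * (g + k)"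
| "path_length k g (Within j) = j * (g + k)"

text \<open>An invariant of \<open>step\<close> that bounds \<open>path_length\<close> uniformly;
  \<open>c < k\<close> keeps \<open>path_length\<close> positive while seeking.\<close>

fun valid_state :: "nat \<Rightarrow> nat \<Rightarrow> nat \<Rightarrow> state \<Rightarrow> bool" where
  "valid_state k g r (Seek d c j) \<longleftrightarrow> d < g \<and> c < k \<and> j \<le> r"
| "valid_state k g r (Within j) \<longleftrightarrow> j \<le> r"

lemma valid_state_step:
  assumes "1 \<le> k" "1 \<le> g" "valid_state k g r st"
  shows "valid_state k g r (step k g st b)"
  using assms by (cases "(st, b)" rule: step.cases) auto

lemma path_length_le: "valid_state k g r st \<Longrightarrow> path_length k g st \<le> g + k + r * (g + k)"
proof (cases st)
  case (Seek d c j)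
  assume "valid_state k g r st"
  then have "j * (g + k) \<le> r * (g + k)" "d < g" using Seek by auto
  then show ?thesis unfolding Seek path_length.simps by linarith
next
  case (Within j)
  assume "valid_state k g r st"
  then have "j * (g + k) \<le> r * (g + k)" using Within by simp
  then show ?thesis unfolding Within path_length.simps by linarith
qed

text \<open>A success is favourable while seeking, a failure once a run has length
  \<open>k\<close>.\<close>

lemma path_length_step:
  assumes "1 \<le> k" "1 \<le> g" "valid_state k g r st" "st \<noteq> Within 0"
  obtains b where "path_length k g (step k g st b) < path_length k g st"
proof (cases "(st, True)" rule: step.cases)
  case (2 c j)
  have "path_length k g (step k g st True) < path_length k g st"
    using 2 assms(3) by auto
  then show ?thesis by (rule that)
next
  case (5 j)
  then show ?thesis using assms that[of False] by auto
qed (use assms that[of True] in auto)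

text \<open>The favourable path fits into \<open>m\<close> trials and has probability at least
  \<open>min p (1 - p) ^ m\<close>. Off this path, \<open>n\<close> trials still remain, so the
  chance of missing is at most \<open>B\<close>.\<close>

lemma hit_prob_drift:
  assumes k: "1 \<le> k" and g: "1 \<le> g" and p: "0 < p" "p < 1"
    and B: "\<And>st. valid_state k g r st \<Longrightarrow> 1 - hit_prob k g p n st \<le> B"
  shows "valid_state k g r st \<Longrightarrow> path_length k g st \<le> m \<Longrightarrow>
    1 - hit_prob k g p (n + m) st \<le> (1 - min p (1 - p) ^ m) * B"
proof (induction m arbitrary: st)
  case 0
  then have "st = Within 0" using k by (cases st) auto
  then show ?case by simp
next
  case (Suc m)
  let ?e = "min p (1 - p)" and ?Q = "\<lambda>b. 1 - hit_prob k g p (n + m) (step k g st b)"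
  let ?P = "\<lambda>b. if b then p else 1 - p"
  have e: "0 < ?e" "?e < 1" using p by auto
  have B0: "0 \<le> B" using B[of "Within 0"] by simp
  show ?case
  proof (cases "st = Within 0")
    case True
    then show ?thesis using B0 e by (simp add: power_le_one del: power_Suc)
  next
    case False
    obtain b where b: "path_length k g (step k g st b) < path_length k g st"
      using path_length_step[OF k g Suc.prems(1) False] .
    note v = valid_state_step[OF k g Suc.prems(1)]
    have 1: "?Q b \<le> (1 - ?e ^ m) * B" using Suc.IH[OF v] b Suc.prems(2) by simp
    \<comment> \<open>After the unfavourable outcome, monotonicity in time discards the extra
      \<open>m\<close> trials.\<close>
    have 2: "?Q (\<not> b) \<le> B"
      using B[OF v, of "\<not> b"] hit_prob_mono[of p n "n + m" k g "step k g st (\<not> b)"] p by simp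
    have P: "?e \<le> ?P b" "0 \<le> ?P (\<not> b)" "?P (\<not> b) = 1 - ?P b" using p by auto
    have "1 - hit_prob k g p (n + Suc m) st = ?P b * ?Q b + ?P (\<not> b) * ?Q (\<not> b)"
      by (cases b) (auto simp: algebra_simps)
    also have "\<dots> \<le> ?P b * ((1 - ?e ^ m) * B) + ?P (\<not> b) * B"
      using 1 2 P e by (intro add_mono mult_left_mono) linarith+
    also have "\<dots> = B - ?P b * (?e ^ m * B)" unfolding P(3) by (simp add: algebra_simps)
    also have "\<dots> \<le> B - ?e * (?e ^ m * B)"
      using P(1) B0 e by (intro diff_left_mono mult_right_mono) auto
    also have "\<dots> = (1 - ?e ^ Suc m) * B" by (simp add: algebra_simps)
    finally show ?thesis .
  qed
qed

text \<open>Each stretch of \<open>L\<close> trials multiplies the chance of missing by at most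
  \<rho>, uniformly over valid states; \<theta> spreads this factor evenly over the \<open>L\<close>
  trials.\<close>

lemma hit_prob_tail:
  assumes k: "1 \<le> k" and g: "1 \<le> g" and p: "0 < p" "p < 1"
  obtains C \<theta> where "0 < \<theta>" "\<theta> < 1" "\<And>n. 1 - hit_prob k g p n (Seek 0 0 r) \<le> C * \<theta> ^ n"
proof -
  define L where "L = g + k + r * (g + k)"
  define \<rho> where "\<rho> = 1 - min p (1 - p) ^ L"
  have L: "0 < L" using k by (simp add: L_def)
  have e: "0 < min p (1 - p)" "min p (1 - p) < 1" using p by auto
  have "0 < min p (1 - p) ^ L" "min p (1 - p) ^ L < 1"
    using power_Suc_less_one[OF e, of "L - 1"] L by (simp_all add: e(1) del: min_less_iff_conj)
  then have \<rho>: "0 < \<rho>" "\<rho> < 1" unfolding \<rho>_def by linarith+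
  have block: "1 - hit_prob k g p (i * L) st \<le> \<rho> ^ i" if "valid_state k g r st" for i st
    using that
  proof (induction i arbitrary: st)
    case 0
    then show ?case using hit_prob_bounds[of p k g 0 st] p by (simp del: hit_prob.simps)
  next
    case (Suc i)
    have "1 - hit_prob k g p (i * L + L) st \<le> \<rho> * \<rho> ^ i"
      unfolding \<rho>_def
      by (rule hit_prob_drift[OF k g p _ Suc.prems])
        (use Suc.IH path_length_le[OF Suc.prems] in \<open>auto simp: \<rho>_def L_def\<close>)
    then show ?case by (simp add: add.commute)
  qed
  define \<theta> where "\<theta> = root L \<rho>"
  have \<theta>: "0 < \<theta>" "\<theta> < 1" "\<theta> ^ L = \<rho>"
    using \<rho> L by (auto simp: \<theta>_def)
  \<comment> \<open>The factor \<open>inverse \<rho>\<close> pays for the incomplete last stretch,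
    as \<open>\<theta> ^ L = \<rho>\<close> is at most \<open>\<theta> ^ (n mod L)\<close>.\<close>
  have "1 - hit_prob k g p n (Seek 0 0 r) \<le> inverse \<rho> * \<theta> ^ n" for n
  proof -
    have "1 - hit_prob k g p n (Seek 0 0 r) \<le> 1 - hit_prob k g p (n div L * L) (Seek 0 0 r)"
      using hit_prob_mono[of p "n div L * L" n k g "Seek 0 0 r"] p by simp
    also have "\<dots> \<le> \<rho> ^ (n div L)" using block[of "Seek 0 0 r"] k g by simp
    also have "\<dots> = inverse \<rho> * (\<theta> ^ (n div L * L) * \<theta> ^ L)"
      using \<rho> \<theta>(3) by (simp add: power_mult mult.commute[of _ L])
    also have "\<dots> \<le> inverse \<rho> * (\<theta> ^ (n div L * L) * \<theta> ^ (n mod L))"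
      using \<rho> \<theta> L by (intro mult_left_mono power_decreasing) (auto intro: less_imp_le)
    also have "\<theta> ^ (n div L * L) * \<theta> ^ (n mod L) = \<theta> ^ n"
      by (simp flip: power_add)
    finally show ?thesis .
  qed
  then show ?thesis using that \<theta> by blast
qed

section \<open>The distribution of the waiting time\<close>

lemma sets_stake: "{\<omega>. P (stake n \<omega>)} \<in> sets (trials p)"
proof -
  have "stake n \<in> stream_space (count_space UNIV) \<rightarrow>\<^sub>M count_space (UNIV :: bool list set)"
    by measurable
  then have "stake n \<in> trials p \<rightarrow>\<^sub>M count_space (UNIV :: bool list set)"
    using sets_stream_space_cong[of "measure_pmf (bernoulli_pmf p)" "count_space UNIV"]
    by (simp cong: measurable_cong_sets)
  from measurable_sets[OF this, of "Collect P"] show ?thesis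
    by (simp add: vimage_def space_stream_space)
qed

text \<open>The stream measure splits into the first trial and an independent stream with the same
  law, which reproduces the recursion of \<open>hit_prob\<close>.\<close>

lemma emeasure_hit:
  assumes p: "0 \<le> p" "p \<le> 1"
  shows "emeasure (trials p) {\<omega>. foldl (step k g) st (stake n \<omega>) = Within 0} = hit_prob k g p n st"
proof (induction n arbitrary: st)
  case 0
  interpret S: prob_space "trials p"
    by (intro prob_space.prob_space_stream_space measure_pmf.prob_space_axioms)
  have "space (trials p) = UNIV" by (simp add: space_stream_space)
  then show ?case using S.emeasure_space_1 by auto
next
  case (Suc n)
  have bounds: "0 \<le> hit_prob k g p n st" for st using hit_prob_bounds[OF p] by blast
  have "emeasure (trials p) {\<omega>. foldl (step k g) st (stake (Suc n) \<omega>) = Within 0} =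
    (\<integral>\<^sup>+t. emeasure (trials p) {\<omega>. foldl (step k g) (step k g st t) (stake n \<omega>) = Within 0} \<partial>bernoulli_pmf p)"
    by (subst prob_space.emeasure_stream_space[OF measure_pmf.prob_space_axioms], rule sets_stake) (simp add: space_stream_space)
  also have "\<dots> = hit_prob k g p (Suc n) st"
    using p bounds by (simp add: Suc.IH ennreal_mult[symmetric] ennreal_plus[symmetric] mult.commute del: ennreal_plus)
  finally show ?case .
qed

text \<open>The probability of ever hitting is at least every
  \<open>hit_prob k g p n (Seek 0 0 r)\<close>, and these tend to 1 by the geometric tail.\<close>

lemma AE_hit:
  assumes k: "1 \<le> k" and g: "1 \<le> g" and p: "0 < p" "p < 1"
  shows "AE \<omega> in trials p. \<exists>n. foldl (step k g) (Seek 0 0 r) (stake n \<omega>) = Within 0"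
proof -
  interpret S: prob_space "trials p"
    by (intro prob_space.prob_space_stream_space measure_pmf.prob_space_axioms)
  define A where "A n = {\<omega>. foldl (step k g) (Seek 0 0 r) (stake n \<omega>) = Within 0}" for n
  obtain C \<theta> where \<theta>: "0 < \<theta>" "\<theta> < 1" "\<And>n. 1 - hit_prob k g p n (Seek 0 0 r) \<le> C * \<theta> ^ n"
    using hit_prob_tail[OF k g p] by blast
  have sets: "A n \<in> S.events" for n unfolding A_def by (rule sets_stake)
  have "1 - S.prob (\<Union>n. A n) \<le> C * \<theta> ^ n" for n
  proof -
    have "S.prob (A n) = hit_prob k g p n (Seek 0 0 r)"
      using emeasure_hit[of p k g "Seek 0 0 r" n] hit_prob_bounds[of p k g n "Seek 0 0 r"] p
      by (simp add: A_def measure_def)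
    moreover have "S.prob (A n) \<le> S.prob (\<Union>n. A n)"
      using sets by (intro S.finite_measure_mono) auto
    ultimately show ?thesis using \<theta>(3)[of n] by simp
  qed
  moreover have "(\<lambda>n. C * \<theta> ^ n) \<longlonglongrightarrow> C * 0"
    using \<theta> by (intro tendsto_mult tendsto_const LIMSEQ_power_zero) auto
  ultimately have "1 - S.prob (\<Union>n. A n) \<le> 0"
    by (intro LIMSEQ_le_const[of "\<lambda>n. C * \<theta> ^ n"]) auto
  then have "S.prob (\<Union>n. A n) = 1" using S.prob_le_1[of "\<Union>n. A n"] by linarith
  from S.AE_prob_1[OF this] show ?thesis by (simp add: A_def)
qed

text \<open>The two events agree off the null set where \<open>Within 0\<close> is never hit. The
  index \<open>Suc r\<close> matches \<open>Seek 0 0 r\<close>, which counts the runs after the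
  first.\<close>

lemma measure_NB_II_atMost:
  assumes k: "1 \<le> k" and g: "1 \<le> g" and p: "0 < p" "p < 1"
  shows "measure (NB_II p k g (Suc r)) {..m} = hit_prob k g p m (Seek 0 0 r)"
proof -
  interpret S: prob_space "trials p"
    by (intro prob_space.prob_space_stream_space measure_pmf.prob_space_axioms)
  let ?W = "\<lambda>\<omega>. waiting_time k g (Suc r) (outcome \<omega>)"
  note W = measurable_waiting_time[OF k, of g "Suc r" p]
  have sp: "space (trials p) = UNIV" by (simp add: space_stream_space)
  have "emeasure (NB_II p k g (Suc r)) {..m} = emeasure (trials p) (?W -` {..m})"
    unfolding NB_II_def by (subst emeasure_distr[OF W]) (simp_all add: sp)
  also have "\<dots> = emeasure (trials p) {\<omega>. foldl (step k g) (Seek 0 0 r) (stake m \<omega>) = Within 0}"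
  proof (rule emeasure_eq_AE)
    show "AE \<omega> in trials p. \<omega> \<in> ?W -` {..m} \<longleftrightarrow>
      \<omega> \<in> {\<omega>. foldl (step k g) (Seek 0 0 r) (stake m \<omega>) = Within 0}"
      using AE_hit[OF k g p, of r]
    proof eventually_elim
      case (elim \<omega>)
      then obtain n where "foldl (step k g) (Seek 0 0 r) (stake n \<omega>) = Within 0" by blast
      then have "traj k g (outcome \<omega>) (Seek 0 0 r) n = Within 0" unfolding traj_outcome .
      from waiting_time_le_iff[OF k g this, of m] show ?case unfolding traj_outcome by simp
    qed
    show "?W -` {..m} \<in> S.events" using measurable_sets[OF W, of "{..m}"] by (simp add: sp)
  qed (rule sets_stake)
  also have "\<dots> = hit_prob k g p m (Seek 0 0 r)" using p by (simp add: emeasure_hit)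
  finally show ?thesis
    using hit_prob_bounds[of p k g m "Seek 0 0 r"] p by (simp add: measure_def)
qed

section \<open>Comparison of distribution functions\<close>

lemma measure_nat_singleton_Suc:
  assumes "finite_measure M" "sets M = (UNIV :: nat set set)"
  shows "measure M {Suc n} = measure M {..Suc n} - measure M {..n}"
proof -
  have "{Suc n} = {..Suc n} - {..n}" by auto
  then show ?thesis using finite_measure.finite_measure_Diff[OF assms(1), of "{..Suc n}" "{..n}"] assms(2) by simp
qed

lemma nat_measure_eqI:
  fixes M N :: "nat measure"
  assumes M: "finite_measure M" "sets M = UNIV" and N: "finite_measure N" "sets N = UNIV"
    and eq: "\<And>m. measure M {..m} = measure N {..m}"
  shows "M = N"
proof (rule measure_eqI_countable[of M UNIV N])
  fix n :: nat
  have "measure M {n} = measure N {n}"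
  proof (cases n)
    case 0
    have "{0} = {..0 :: nat}" by auto
    then show ?thesis using eq[of 0] 0 by simp
  next
    case (Suc m)
    then show ?thesis by (simp add: measure_nat_singleton_Suc[OF M] measure_nat_singleton_Suc[OF N] eq)
  qed
  then show "emeasure M {n} = emeasure N {n}"
    using M(1) N(1) by (simp add: finite_measure.emeasure_eq_measure)
qed (use M N in auto)

lemma sets_NB_II [simp]: "sets (NB_II p k g r) = UNIV"
  by (simp add: NB_II_def)

text \<open>At \<open>m \<ge> r * (g - 1)\<close> the distribution functions agree by
  \<open>hit_prob_gap\<close>; below that both vanish.\<close>

lemma NB_II_gap_shift:
  assumes k: "1 \<le> k" and g: "1 \<le> g" and p: "0 < p" "p < 1"
  shows "NB_II p k g (Suc r) = distr (NB_II p k 1 (Suc r)) (count_space UNIV) (\<lambda>n. n + r * (g - 1))"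
    (is "?M = distr ?N _ ?f")
proof (rule nat_measure_eqI)
  interpret M: prob_space ?M by (rule prob_space_NB_II[OF k])
  interpret N: prob_space ?N by (rule prob_space_NB_II[OF k])
  have f: "?f \<in> ?N \<rightarrow>\<^sub>M count_space UNIV"
    by (simp add: measurable_def)
  show "finite_measure ?M" by unfold_locales
  show "finite_measure (distr ?N (count_space UNIV) ?f)"
    using N.prob_space_distr[OF f] by (rule prob_space.finite_measure)
  fix m
  have sp: "space ?N = UNIV" by (simp add: NB_II_def)
  have "measure (distr ?N (count_space UNIV) ?f) {..m} = measure ?N (?f -` {..m})"
    by (subst measure_distr[OF f]) (simp_all add: sp)
  also have "\<dots> = hit_prob k g p m (Seek 0 0 r)"
  proof (cases "r * (g - 1) \<le> m")
    case True
    then have "?f -` {..m} = {..m - r * (g - 1)}" by auto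
    then show ?thesis
      using measure_NB_II_atMost[OF k _ p, of 1 r "m - r * (g - 1)"]
        hit_prob_gap[OF g, of k p "m - r * (g - 1)" r 0] True by simp
  next
    case False
    then have "?f -` {..m} = {}" by auto
    moreover have "hit_prob k g p m (Seek 0 0 r) = 0"
      by (rule hit_prob_eq_0) (use False in simp)
    ultimately show ?thesis by (metis measure_empty)
  qed
  finally show "measure ?M {..m} = measure (distr ?N (count_space UNIV) ?f) {..m}"
    using measure_NB_II_atMost[OF k g p] by simp
qed simp_all

section \<open>Existence of the first two moments\<close>

text \<open>Comparison with the twice differentiated geometric series, whose coefficients are
  \<open>(n + 1) * (n + 2)\<close>.\<close>

lemma summable_square_geometric:
  fixes \<theta> :: real
  assumes "0 \<le> \<theta>" "\<theta> < 1"
  shows "summable (\<lambda>n. (real (Suc n))\<^sup>2 * \<theta> ^ n)"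
proof -
  have 0: "summable (\<lambda>n. 1 * x ^ n)" if "norm x < 1" for x :: real
    using that by (simp add: summable_geometric)
  have 1: "summable (\<lambda>n. diffs (\<lambda>_. 1) n * x ^ n)" if "norm x < 1" for x :: real
    by (rule termdiff_converges[OF that 0])
  have "summable (\<lambda>n. diffs (diffs (\<lambda>_. 1)) n * \<theta> ^ n)"
    by (rule termdiff_converges[OF _ 1, where K = 1]) (use assms in auto)
  then show ?thesis
  proof (rule summable_comparison_test'[where N = 0])
    fix n :: nat
    have "(real (Suc n))\<^sup>2 * \<theta> ^ n \<le> (real (Suc n) * real (Suc (Suc n))) * \<theta> ^ n"
      unfolding power2_eq_square using assms by (intro mult_right_mono mult_left_mono) auto
    then show "norm ((real (Suc n))\<^sup>2 * \<theta> ^ n) \<le> diffs (diffs (\<lambda>_. 1)) n * \<theta> ^ n"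
      using assms by (simp add: diffs_def)
  qed
qed

text \<open>\<open>M\<close> has its point masses as density with respect to counting measure, which
  turns integrability into absolute summability.\<close>

lemma integrable_nat_measure:
  fixes f :: "nat \<Rightarrow> real"
  assumes "finite_measure M" "sets M = UNIV" "summable (\<lambda>n. measure M {n} * \<bar>f n\<bar>)"
  shows "integrable M f"
proof -
  have "M = density (count_space UNIV) (\<lambda>n. ennreal (measure M {n}))"
  proof (rule measure_eqI_countable[of _ UNIV])
    fix n
    show "emeasure M {n} = emeasure (density (count_space UNIV) (\<lambda>n. ennreal (measure M {n}))) {n}"
      using assms(1) by (simp add: emeasure_density finite_measure.emeasure_eq_measure)
  qed (use assms in auto)
  moreover have "integrable (count_space UNIV) (\<lambda>n. measure M {n} *\<^sub>R f n)"
    using assms(3) by (simp add: integrable_count_space_nat_iff abs_mult)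
  then have "integrable (density (count_space UNIV) (\<lambda>n. ennreal (measure M {n}))) f"
    by (subst integrable_density) auto
  ultimately show ?thesis by metis
qed

text \<open>The mass at \<open>Suc n\<close> is at most the tail beyond \<open>n\<close>, hence at
  most \<open>C * \<theta> ^ n\<close>.\<close>

lemma integrable_NB_II_square:
  assumes k: "1 \<le> k" and g: "1 \<le> g" and p: "0 < p" "p < 1"
  shows "integrable (NB_II p k g (Suc r)) (\<lambda>n. (real n)\<^sup>2)"
proof (rule integrable_nat_measure)
  let ?M = "NB_II p k g (Suc r)"
  interpret M: prob_space ?M by (rule prob_space_NB_II[OF k])
  show fin: "finite_measure ?M" by unfold_locales
  obtain C \<theta> where \<theta>: "0 < \<theta>" "\<theta> < 1" "\<And>n. 1 - hit_prob k g p n (Seek 0 0 r) \<le> C * \<theta> ^ n"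
    using hit_prob_tail[OF k g p] by blast
  have "summable (\<lambda>n. C * ((real (Suc n))\<^sup>2 * \<theta> ^ n))"
    using \<theta> by (intro summable_mult summable_square_geometric) auto
  then have "summable (\<lambda>n. measure ?M {Suc n} * (real (Suc n))\<^sup>2)"
  proof (rule summable_comparison_test'[where N = 0])
    fix n
    have "measure ?M {Suc n} \<le> C * \<theta> ^ n"
      using \<theta>(3)[of n] hit_prob_bounds[of p k g "Suc n" "Seek 0 0 r"] p
      by (simp add: measure_nat_singleton_Suc[OF fin] measure_NB_II_atMost[OF k g p] del: hit_prob.simps)
    then have "measure ?M {Suc n} * (real (Suc n))\<^sup>2 \<le> C * \<theta> ^ n * (real (Suc n))\<^sup>2"
      by (intro mult_right_mono) auto
    then show "norm (measure ?M {Suc n} * (real (Suc n))\<^sup>2) \<le> C * ((real (Suc n))\<^sup>2 * \<theta> ^ n)"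
      by (simp add: mult_ac)
  qed
  then show "summable (\<lambda>n. measure ?M {n} * \<bar>(real n)\<^sup>2\<bar>)"
    by (subst summable_Suc_iff[symmetric]) simp
qed simp

lemma integrable_NB_II:
  assumes "1 \<le> k" and "1 \<le> g" and "0 < p" "p < 1"
  shows "integrable (NB_II p k g (Suc r)) real"
proof (rule Bochner_Integration.integrable_bound[OF integrable_NB_II_square[OF assms, of r]])
  show "AE n in NB_II p k g (Suc r). norm (real n) \<le> norm ((real n)\<^sup>2)"
    by (intro AE_I2) (auto simp: power2_eq_square simp flip: of_nat_mult)
qed (simp add: measurable_def)

text \<open>Integrability accompanies the moment identities because the Bochner integral of a
  non-integrable function is 0 by convention.\<close>

theorem mainTheorem9:
  fixes k g r :: nat and p :: real
  assumes "1 \<le> k" and "1 \<le> g" and "1 \<le> r" and "0 < p" and "p < 1"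
  shows "(\<forall>(M :: 'a measure) X (N :: 'b measure) W.
            has_NB_II M X p k g r \<and> has_NB_II N W p k 1 r \<longrightarrow>
            distr M (count_space UNIV) X =
              distr N (count_space UNIV) (\<lambda>x. W x + (r - 1) * (g - 1)))
       \<and> integrable (NB_II p k g r) real
       \<and> integrable (NB_II p k g r) (\<lambda>n. (real n)\<^sup>2)
       \<and> NB_II_mean p k g r = NB_II_mean p k 1 r + (real r - 1) * (real g - 1)
       \<and> NB_II_variance p k g r = NB_II_variance p k 1 r"
proof -
  obtain i where r: "r = Suc i" using assms(3) by (cases r) auto
  let ?N = "NB_II p k 1 r" and ?c = "(r - 1) * (g - 1)"
  interpret N: prob_space ?N by (rule prob_space_NB_II[OF assms(1)])
  have shift: "NB_II p k g r = distr ?N (count_space UNIV) (\<lambda>n. n + ?c)"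
    using NB_II_gap_shift[OF assms(1,2,4,5), of i] by (simp add: r)
  have meas: "(\<lambda>n. n + ?c) \<in> ?N \<rightarrow>\<^sub>M count_space UNIV" by (simp add: measurable_def)
  have int: "integrable ?N real"
    using integrable_NB_II[OF assms(1) _ assms(4,5), of 1 i] by (simp add: r)
  \<comment> \<open>Since \<open>r\<close> and \<open>g\<close> are at least 1, the natural
    subtractions in \<open>?c\<close> do not truncate.\<close>
  have c: "real ?c = (real r - 1) * (real g - 1)" using assms by (simp add: of_nat_diff)
  have "distr M (count_space UNIV) X = distr N (count_space UNIV) (\<lambda>x. W x + ?c)"
    if "has_NB_II M X p k g r" "has_NB_II N W p k 1 r" for M :: "'a measure" and X and N :: "'b measure" and W
  proof -
    have W: "W \<in> N \<rightarrow>\<^sub>M count_space UNIV" "distr N (count_space UNIV) W = ?N"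
      using that(2) by (auto simp: has_NB_II_def)
    have "distr M (count_space UNIV) X = NB_II p k g r" using that(1) by (simp add: has_NB_II_def)
    also have "\<dots> = distr (distr N (count_space UNIV) W) (count_space UNIV) (\<lambda>n. n + ?c)"
      unfolding shift W(2) ..
    also have "\<dots> = distr N (count_space UNIV) (\<lambda>x. W x + ?c)"
      by (subst distr_distr[OF _ W(1)]) (simp_all add: comp_def)
    finally show ?thesis .
  qed
  moreover have mean: "NB_II_mean p k g r = NB_II_mean p k 1 r + real ?c"
  proof -
    have "NB_II_mean p k g r = (\<integral>n. real n + real ?c \<partial>?N)"
      unfolding NB_II_mean_def shift by (subst integral_distr[OF meas]) simp_all
    also have "\<dots> = NB_II_mean p k 1 r + (\<integral>n. real ?c \<partial>?N)"
      unfolding NB_II_mean_def by (rule Bochner_Integration.integral_add[OF int N.integrable_const])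
    also have "(\<integral>n. real ?c \<partial>?N) = real ?c"
      unfolding lebesgue_integral_const N.prob_space by simp
    finally show ?thesis .
  qed
  moreover have "NB_II_variance p k g r = NB_II_variance p k 1 r"
  proof -
    \<comment> \<open>Transported to \<open>?N\<close>, the shift \<open>?c\<close> of the variable
      cancels against that of the mean.\<close>
    have "NB_II_variance p k g r = (\<integral>n. (real (n + ?c) - NB_II_mean p k g r)\<^sup>2 \<partial>?N)"
      unfolding NB_II_variance_def NB_II_mean_def shift
      by (subst integral_distr[OF meas]) simp_all
    then show ?thesis unfolding mean by (simp add: NB_II_variance_def NB_II_mean_def)
  qed
  moreover have "integrable (NB_II p k g r) real" "integrable (NB_II p k g r) (\<lambda>n. (real n)\<^sup>2)"
    using integrable_NB_II[OF assms(1,2,4,5)] integrable_NB_II_square[OF assms(1,2,4,5)] by (simp_all add: r)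
  ultimately show ?thesis unfolding c by blast
qed

end
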